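(* Let $p\ge 1$ be an integer. Then for every real number $x$, $$\sum_{n=2}^{\infty}\left(1^p+2^p+\dots+(n-1)^p\right)\frac{x^n}{n!}=\sum_{n=1}^{\infty}n^p\left(e^x-1-\frac{x}{1!}-\frac{x^2}{2!}-\dots-\frac{x^n}{n!}\right).$$ *)

theory Defs
  imports Complex_Main
begin

end

theory Submission
  imports Defs
begin

text \<open>
  Abel summation on partial sums: the two sides, cut off at \<open>N\<close>, differ by the product of
  \<open>1^p + \<dots> + N^p \<le> N^(p+1)\<close> and the exponential tail after index \<open>N + 1\<close>. This product is
  dominated by a tail of the convergent series of \<open>n^(p+1) \<bar>x\<bar>^n / n!\<close>, hence tends to \<open>0\<close>.
\<close>

text \<open>No term of the exponential series at \<open>y\<close> is negative, so the single term of
  index \<open>q\<close> is at most the whole sum.\<close>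

lemma power_le_fact_mult_exp:
  fixes y :: real
  assumes "0 \<le> y"
  shows "y ^ q \<le> fact q * exp y"
proof -
  have "(\<Sum>k\<in>{q}. y ^ k /\<^sub>R fact k) \<le> (\<Sum>k. y ^ k /\<^sub>R fact k)"
    by (rule sum_le_suminf) (use assms summable_exp_generic[of y] in auto)
  then have "y ^ q / fact q \<le> exp y"
    by (simp add: exp_def divide_inverse mult.commute)
  then show ?thesis
    by (simp add: field_simps)
qed

text \<open>Trading \<open>real n ^ q\<close> for \<open>fact q * exp (real n)\<close> lets the
  polynomial factor be absorbed into the base of the power: what dominates is a constant multiple of
  the exponential series at \<open>exp 1 * \<bar>x\<bar>\<close>.\<close>

lemma summable_power_mult_exp_terms:
  fixes x :: real
  shows "summable (\<lambda>n. real n ^ q * (\<bar>x\<bar> ^ n / fact n))"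
proof (rule summable_comparison_test)
  show "summable (\<lambda>n. fact q * (inverse (fact n) * (exp 1 * \<bar>x\<bar>) ^ n))"
    by (intro summable_mult summable_exp)
  have "real n ^ q * (\<bar>x\<bar> ^ n / fact n) \<le> fact q * (inverse (fact n) * (exp 1 * \<bar>x\<bar>) ^ n)" for n
  proof -
    have "real n ^ q * (\<bar>x\<bar> ^ n / fact n) \<le> (fact q * exp (real n)) * (\<bar>x\<bar> ^ n / fact n)"
      by (intro mult_right_mono power_le_fact_mult_exp) auto
    also have "\<dots> = fact q * (inverse (fact n) * (exp 1 * \<bar>x\<bar>) ^ n)"
      by (simp add: power_mult_distrib exp_of_nat_mult[of n 1, simplified] divide_inverse)
    finally show ?thesis .
  qed
  then show "\<exists>N. \<forall>n\<ge>N. norm (real n ^ q * (\<bar>x\<bar> ^ n / fact n))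
      \<le> fact q * (inverse (fact n) * (exp 1 * \<bar>x\<bar>) ^ n)"
    by (auto simp: abs_mult power_abs)
qed

text \<open>As a series of its own the tail can be estimated term by term; its summability is what
  allows a constant factor to be moved inside.\<close>

lemma exp_tail_eq:
  fixes x :: real
  shows "exp x - (\<Sum>k=0..m. x ^ k / fact k) = (\<Sum>k. x ^ (k + Suc m) / fact (k + Suc m))"
    and "summable (\<lambda>k. x ^ (k + Suc m) / fact (k + Suc m))"
proof -
  have s: "summable (\<lambda>k. x ^ k / fact k)"
    using summable_exp[of x] by (simp add: divide_inverse mult.commute)
  have e: "exp x = (\<Sum>k. x ^ k / fact k)"
    by (simp add: exp_def divide_inverse mult.commute)
  show "exp x - (\<Sum>k=0..m. x ^ k / fact k) = (\<Sum>k. x ^ (k + Suc m) / fact (k + Suc m))"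
    unfolding e suminf_minus_initial_segment[OF s]
    by (simp only: atLeast0AtMost lessThan_Suc_atMost)
  show "summable (\<lambda>k. x ^ (k + Suc m) / fact (k + Suc m))"
    using summable_ignore_initial_segment[OF s] .
qed

text \<open>Every index \<open>k + Suc m\<close> in the tail exceeds \<open>m\<close>, so
  \<open>real m ^ q\<close> can be moved inside the sum and enlarged to
  \<open>real (k + Suc m) ^ q\<close>.\<close>

lemma power_mult_exp_tail_tendsto_0:
  fixes x :: real
  shows "(\<lambda>m. real m ^ q * (exp x - (\<Sum>k=0..m. x ^ k / fact k))) \<longlonglongrightarrow> 0"
proof -
  let ?c = "\<lambda>n. real n ^ q * (\<bar>x\<bar> ^ n / fact n)"
  have sc: "summable (\<lambda>k. ?c (k + m))" for m
    using summable_ignore_initial_segment[OF summable_power_mult_exp_terms] .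
  have bound: "norm (real m ^ q * (exp x - (\<Sum>k=0..m. x ^ k / fact k))) \<le> (\<Sum>k. ?c (k + Suc m))"
    for m
  proof -
    have "norm (real m ^ q * (x ^ (k + Suc m) / fact (k + Suc m))) \<le> ?c (k + Suc m)" for k
      unfolding norm_mult norm_divide norm_power
      by (intro mult_mono power_mono) auto
    then have "norm (\<Sum>k. real m ^ q * (x ^ (k + Suc m) / fact (k + Suc m)))
        \<le> (\<Sum>k. ?c (k + Suc m))"
      by (intro norm_suminf_le sc)
    then show ?thesis
      by (simp only: exp_tail_eq suminf_mult[OF exp_tail_eq(2)])
  qed
  have s: "summable ?c"
    by (rule summable_power_mult_exp_terms)
  have "(\<lambda>m. (\<Sum>k. ?c k) - (\<Sum>k<m. ?c k)) \<longlonglongrightarrow> (\<Sum>k. ?c k) - (\<Sum>k. ?c k)"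
    by (intro tendsto_diff tendsto_const summable_LIMSEQ s)
  then have "(\<lambda>m. \<Sum>k. ?c (k + m)) \<longlonglongrightarrow> 0"
    by (simp only: suminf_minus_initial_segment[OF s] diff_self)
  then have "(\<lambda>m. \<Sum>k. ?c (k + Suc m)) \<longlonglongrightarrow> 0"
    by (rule LIMSEQ_Suc)
  then show ?thesis
    by (rule tendsto_0_le[where K = 1])
      (use order_trans[OF bound abs_ge_self] in \<open>simp only: real_norm_def mult_1_right eventually_True\<close>)
qed

lemma sum_powers_le: "(\<Sum>k=1..m. real k ^ p) \<le> real m ^ Suc p"
proof -
  have "(\<Sum>k=1..m. real k ^ p) \<le> (\<Sum>k=1..m. real m ^ p)"
    by (intro sum_mono power_mono) auto
  then show ?thesis by simp
qed

lemma sum_power_exp_tails_eq: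
  fixes x :: real
  defines "T \<equiv> \<lambda>m. exp x - (\<Sum>k=0..m. x ^ k / fact k)"
  shows "(\<Sum>n<N. real (n + 1) ^ p * T (n + 1)) =
    (\<Sum>n<N. (\<Sum>k=1..n+2-1. real k ^ p) * (x ^ (n + 2) / fact (n + 2)))
      + (\<Sum>k=1..N. real k ^ p) * T (N + 1)"
proof (induction N)
  case 0
  then show ?case by simp
next
  case (Suc N)
  \<comment> \<open>The old boundary term and the new summand on the left both carry the factor
    \<open>T (N + 1)\<close>, and together their coefficient is the power sum up to
    \<open>N + 1\<close>. Splitting off the leading term of this tail yields the new summand on the
    right and the new boundary term.\<close>
  have T: "T (N + 1) = T (N + 2) + x ^ (N + 2) / fact (N + 2)"
    by (simp add: T_def)
  have s: "(\<Sum>k=1..N+1. real k ^ p) = (\<Sum>k=1..N. real k ^ p) + real (N + 1) ^ p"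
    by simp
  have i: "N + 2 - 1 = N + 1" "Suc N = N + 1" "N + 1 + 1 = N + 2"
    by auto
  show ?case
    unfolding sum.lessThan_Suc Suc.IH unfolding i s T
    by (simp only: ring_distribs add_ac)
qed

theorem mainTheorem4:
  fixes p :: nat and x :: real
  assumes "p \<ge> 1"
  shows "let a = (\<lambda>n::nat. (\<Sum>k=1..n-1. real k ^ p) * (x ^ n / fact n));
             b = (\<lambda>n::nat. real n ^ p * (exp x - (\<Sum>k=0..n. x ^ k / fact k)))
         in summable (\<lambda>n. a (n + 2)) \<and> summable (\<lambda>n. b (n + 1)) \<and>
            (\<Sum>n. a (n + 2)) = (\<Sum>n. b (n + 1))"
proof -
  define T where "T = (\<lambda>m. exp x - (\<Sum>k=0..m. x ^ k / fact k))"
  define a where "a = (\<lambda>n::nat. (\<Sum>k=1..n-1. real k ^ p) * (x ^ n / fact n))"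
  define b where "b = (\<lambda>n::nat. real n ^ p * T n)"
  \<comment> \<open>At \<open>n = 0\<close> the truncated \<open>n - 1\<close> is \<open>0\<close>
    and the sum is empty. Weakening \<open>n - 1\<close> to \<open>n\<close> gives one bound that
    serves both the summability of \<open>a\<close> and the boundary term.\<close>
  have sum_le: "\<bar>\<Sum>k=1..n-1. real k ^ p\<bar> \<le> real n ^ Suc p" for n
  proof -
    have "\<bar>\<Sum>k=1..n-1. real k ^ p\<bar> = (\<Sum>k=1..n-1. real k ^ p)"
      by (intro abs_of_nonneg sum_nonneg) auto
    also have "\<dots> \<le> real (n - 1) ^ Suc p"
      by (rule sum_powers_le)
    also have "\<dots> \<le> real n ^ Suc p"
      by (intro power_mono) auto
    finally show ?thesis .
  qed
  have "norm (a n) \<le> real n ^ Suc p * (\<bar>x\<bar> ^ n / fact n)" for n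
    using mult_right_mono[OF sum_le[of n], of "\<bar>x\<bar> ^ n / fact n"]
    by (simp add: a_def abs_mult power_abs)
  then have "summable a"
    by (intro summable_comparison_test[OF _ summable_power_mult_exp_terms]) blast
  then have sa: "summable (\<lambda>n. a (n + 2))"
    by (rule summable_ignore_initial_segment)
  \<comment> \<open>This is the boundary term with \<open>m = N + 1\<close>, so that the power bound
    and the tail share the index \<open>m\<close>; \<open>LIMSEQ_Suc\<close> then returns to
    \<open>N\<close>.\<close>
  have "(\<lambda>m. (\<Sum>k=1..m-1. real k ^ p) * T m) \<longlonglongrightarrow> 0"
  proof (rule tendsto_0_le[where K = 1])
    show "(\<lambda>m. real m ^ Suc p * T m) \<longlonglongrightarrow> 0"
      unfolding T_def by (rule power_mult_exp_tail_tendsto_0)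
    have "norm ((\<Sum>k=1..m-1. real k ^ p) * T m) \<le> norm (real m ^ Suc p * T m) * 1" for m
      using mult_right_mono[OF sum_le[of m], of "\<bar>T m\<bar>"] by (simp add: abs_mult)
    then show "\<forall>\<^sub>F m in sequentially.
        norm ((\<Sum>k=1..m-1. real k ^ p) * T m) \<le> norm (real m ^ Suc p * T m) * 1"
      by (rule always_eventually[OF allI])
  qed
  from LIMSEQ_Suc[OF this] have "(\<lambda>N. (\<Sum>k=1..N. real k ^ p) * T (N + 1)) \<longlonglongrightarrow> 0"
    by simp
  with summable_LIMSEQ[OF sa]
  have "(\<lambda>N. (\<Sum>n<N. a (n + 2)) + (\<Sum>k=1..N. real k ^ p) * T (N + 1)) \<longlonglongrightarrow> (\<Sum>n. a (n + 2)) + 0"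
    by (rule tendsto_add)
  \<comment> \<open>By the finite identity the sequence above consists of the partial sums of
    \<open>b (n + 1)\<close>, so its limit gives both convergence and value.\<close>
  then have "(\<lambda>n. b (n + 1)) sums (\<Sum>n. a (n + 2))"
    unfolding sums_def a_def b_def T_def sum_power_exp_tails_eq by simp
  then have "summable (\<lambda>n. a (n + 2)) \<and> summable (\<lambda>n. b (n + 1)) \<and>
      (\<Sum>n. a (n + 2)) = (\<Sum>n. b (n + 1))"
    using sa by (auto simp: sums_iff)
  then show ?thesis
    unfolding Let_def a_def b_def T_def .
qed

end
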